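(* Let $A$ be an associative unital ring, let $(\mathcal{C},x)$ be an $A$-coring with a fixed grouplike element $x$, let $B=A^{co\mathcal{C}}$, and assume that $(\mathcal{C},x)$ is a Galois coring. Let $M$ be a right $\mathcal{C}$-comodule and let $N$ be a right $A$-module. Then there is an isomorphism (of abelian groups) $$\mathrm{Hom}_A(M\otimes_A\mathcal{C},N)\simeq \mathrm{Hom}_B(M,N),$$ where $\mathrm{Hom}_A$ and $\mathrm{Hom}_B$ denote right $A$-linear and right $B$-linear maps, respectively.
   Context: An $A$-coring is an $A$-bimodule $\mathcal{C}$ with $A$-bimodule maps $\Delta:\mathcal{C}\to\mathcal{C}\otimes_A\mathcal{C}$, coassociative, and $\varepsilon:\mathcal{C}\to A$, a counit. An element $x\in\mathcal{C}$ is grouplike if $\Delta(x)=x\otimes x$ and $\varepsilon(x)=1$. A right $\mathcal{C}$-comodule is a right $A$-module $M$ with a right $A$-linear map $M\to M\otimes_A\mathcal{C}$ that is coassociative and counital; $\mathcal{M}^{\mathcal{C}}$ is the category of right $\mathcal{C}$-comodules. Given a grouplike element $x$, $A$ is a right $\mathcal{C}$-comodule via $\rho(a)=1\otimes xa\in A\otimes_A\mathcal{C}$, and the subring of coinvariants is $B=A^{co\mathcal{C}}=\{a\in A\mid \rho(a)=a\otimes x\}=\{a\in A\mid ax=xa\}$. Right $A$-modules are regarded as right $B$-modules by restriction. The canonical coring $A\otimes_BA$ is the $A$-coring with $\Delta(a\otimes b)=a\otimes1\otimes b\in A\otimes_BA\otimes_BA\cong(A\otimes_BA)\otimes_A(A\otimes_BA)$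 and $\varepsilon(a\otimes b)=ab$. $(\mathcal{C},x)$ is called a Galois coring if the canonical coring morphism $\mathrm{can}:A\otimes_BA\to\mathcal{C}$, $\mathrm{can}(a\otimes b)=axb$, is an isomorphism. *)

theory Defs
  imports "HOL-Algebra.Free_Abelian_Groups" "HOL-Algebra.Subrings"
begin

section \<open>Right modules, bimodules and their homomorphisms\<close>

text \<open>As for \<open>HOL-Algebra.Module\<close>, a module record extends the ring record, of which
  only the additive part is used.  The library's modules are left modules over commutative rings.\<close>

record ('a, 'm) rmodule = "'m ring" +
  ract :: "'m \<Rightarrow> 'a \<Rightarrow> 'm" (infixl \<open>\<triangleleft>\<index>\<close> 75)

record ('a, 'm) bimodule = "('a, 'm) rmodule" +
  lact :: "'a \<Rightarrow> 'm \<Rightarrow> 'm" (infixr \<open>\<triangleright>\<index>\<close> 76)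

locale right_module = R?: ring A + M?: abelian_group M
  for A :: "('a, 'r) ring_scheme" (structure) and M :: "('a, 'm, 'x) rmodule_scheme" (structure) +
  assumes ract_closed [simp, intro]:
      "\<lbrakk>m \<in> carrier M; a \<in> carrier A\<rbrakk> \<Longrightarrow> m \<triangleleft>\<^bsub>M\<^esub> a \<in> carrier M"
    and ract_add_left:
      "\<lbrakk>m \<in> carrier M; m' \<in> carrier M; a \<in> carrier A\<rbrakk>
        \<Longrightarrow> (m \<oplus>\<^bsub>M\<^esub> m') \<triangleleft>\<^bsub>M\<^esub> a = m \<triangleleft>\<^bsub>M\<^esub> a \<oplus>\<^bsub>M\<^esub> m' \<triangleleft>\<^bsub>M\<^esub> a"
    and ract_add_right:
      "\<lbrakk>m \<in> carrier M; a \<in> carrier A; b \<in> carrier A\<rbrakk>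
        \<Longrightarrow> m \<triangleleft>\<^bsub>M\<^esub> (a \<oplus>\<^bsub>A\<^esub> b) = m \<triangleleft>\<^bsub>M\<^esub> a \<oplus>\<^bsub>M\<^esub> m \<triangleleft>\<^bsub>M\<^esub> b"
    and ract_mult:
      "\<lbrakk>m \<in> carrier M; a \<in> carrier A; b \<in> carrier A\<rbrakk>
        \<Longrightarrow> m \<triangleleft>\<^bsub>M\<^esub> (a \<otimes>\<^bsub>A\<^esub> b) = (m \<triangleleft>\<^bsub>M\<^esub> a) \<triangleleft>\<^bsub>M\<^esub> b"
    and ract_one [simp]:
      "m \<in> carrier M \<Longrightarrow> m \<triangleleft>\<^bsub>M\<^esub> \<one>\<^bsub>A\<^esub> = m"

locale bimodule = right_module A M
  for A :: "('a, 'r) ring_scheme" (structure) and M :: "('a, 'm, 'x) bimodule_scheme" (structure) +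
  assumes lact_closed [simp, intro]:
      "\<lbrakk>m \<in> carrier M; a \<in> carrier A\<rbrakk> \<Longrightarrow> a \<triangleright>\<^bsub>M\<^esub> m \<in> carrier M"
    and lact_add_right:
      "\<lbrakk>m \<in> carrier M; m' \<in> carrier M; a \<in> carrier A\<rbrakk>
        \<Longrightarrow> a \<triangleright>\<^bsub>M\<^esub> (m \<oplus>\<^bsub>M\<^esub> m') = a \<triangleright>\<^bsub>M\<^esub> m \<oplus>\<^bsub>M\<^esub> a \<triangleright>\<^bsub>M\<^esub> m'"
    and lact_add_left:
      "\<lbrakk>m \<in> carrier M; a \<in> carrier A; b \<in> carrier A\<rbrakk>
        \<Longrightarrow> (a \<oplus>\<^bsub>A\<^esub> b) \<triangleright>\<^bsub>M\<^esub> m = a \<triangleright>\<^bsub>M\<^esub> m \<oplus>\<^bsub>M\<^esub> b \<triangleright>\<^bsub>M\<^esub> m"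
    and lact_mult:
      "\<lbrakk>m \<in> carrier M; a \<in> carrier A; b \<in> carrier A\<rbrakk>
        \<Longrightarrow> (a \<otimes>\<^bsub>A\<^esub> b) \<triangleright>\<^bsub>M\<^esub> m = a \<triangleright>\<^bsub>M\<^esub> (b \<triangleright>\<^bsub>M\<^esub> m)"
    and lact_one [simp]:
      "m \<in> carrier M \<Longrightarrow> \<one>\<^bsub>A\<^esub> \<triangleright>\<^bsub>M\<^esub> m = m"
    and lact_ract:
      "\<lbrakk>m \<in> carrier M; a \<in> carrier A; b \<in> carrier A\<rbrakk>
        \<Longrightarrow> (a \<triangleright>\<^bsub>M\<^esub> m) \<triangleleft>\<^bsub>M\<^esub> b = a \<triangleright>\<^bsub>M\<^esub> (m \<triangleleft>\<^bsub>M\<^esub> b)"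

definition regular_bimodule :: "('a, 'r) ring_scheme \<Rightarrow> ('a, 'a) bimodule" where
  "regular_bimodule A = \<lparr>carrier = carrier A, monoid.mult = monoid.mult A, one = \<one>\<^bsub>A\<^esub>,
     ring.zero = \<zero>\<^bsub>A\<^esub>, ring.add = ring.add A, ract = monoid.mult A, lact = monoid.mult A\<rparr>"

text \<open>In the next two definitions \<open>R\<close> is only used through its carrier.  Restricting scalars of
  an \<open>A\<close>-module to a subring \<open>B\<close> needs no new module record: one takes \<open>R = A\<lparr>carrier := B\<rparr>\<close>.\<close>

definition right_linear ::
    "('a, 'r) ring_scheme \<Rightarrow> ('a, 'm, 'x) rmodule_scheme \<Rightarrow> ('a, 'n, 'y) rmodule_scheme
      \<Rightarrow> ('m \<Rightarrow> 'n) set" where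
  "right_linear R M N = {f \<in> hom (add_monoid M) (add_monoid N).
     \<forall>m\<in>carrier M. \<forall>r\<in>carrier R. f (m \<triangleleft>\<^bsub>M\<^esub> r) = f m \<triangleleft>\<^bsub>N\<^esub> r}"

text \<open>Maps are taken extensional, so that two homomorphisms that agree on the carrier are equal.\<close>

definition Hom_group ::
    "('a, 'r) ring_scheme \<Rightarrow> ('a, 'm, 'x) rmodule_scheme \<Rightarrow> ('a, 'n, 'y) rmodule_scheme
      \<Rightarrow> ('m \<Rightarrow> 'n) monoid" where
  "Hom_group R M N = \<lparr>carrier = right_linear R M N \<inter> extensional (carrier M),
     monoid.mult = (\<lambda>f g. \<lambda>m\<in>carrier M. f m \<oplus>\<^bsub>N\<^esub> g m),
     one = (\<lambda>m\<in>carrier M. \<zero>\<^bsub>N\<^esub>)\<rparr>"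

definition bimodule_hom ::
    "('a, 'r) ring_scheme \<Rightarrow> ('a, 'm, 'x) bimodule_scheme \<Rightarrow> ('a, 'n, 'y) bimodule_scheme
      \<Rightarrow> ('m \<Rightarrow> 'n) set" where
  "bimodule_hom A M N = {f \<in> right_linear A M N.
     \<forall>m\<in>carrier M. \<forall>a\<in>carrier A. f (a \<triangleright>\<^bsub>M\<^esub> m) = a \<triangleright>\<^bsub>N\<^esub> f m}"


section \<open>Tensor products over a noncommutative ring\<close>

text \<open>\<open>M \<otimes>\<^sub>R N\<close> is the free abelian group on \<open>M \<times> N\<close> modulo the usual relations, for \<open>M\<close> with
  a right action and \<open>N\<close> with a left action of (at least) \<open>R\<close>.  Its elements are cosets.\<close>

definition tensor_relators ::
    "('a, 'r) ring_scheme \<Rightarrow> ('a, 'm, 'x) rmodule_scheme \<Rightarrow> ('a, 'n, 'y) bimodule_scheme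
      \<Rightarrow> ('m \<times> 'n \<Rightarrow>\<^sub>0 int) set" where
  "tensor_relators R M N =
     {frag_of (m \<oplus>\<^bsub>M\<^esub> m', n) - frag_of (m, n) - frag_of (m', n) | m m' n.
        m \<in> carrier M \<and> m' \<in> carrier M \<and> n \<in> carrier N} \<union>
     {frag_of (m, n \<oplus>\<^bsub>N\<^esub> n') - frag_of (m, n) - frag_of (m, n') | m n n'.
        m \<in> carrier M \<and> n \<in> carrier N \<and> n' \<in> carrier N} \<union>
     {frag_of (m \<triangleleft>\<^bsub>M\<^esub> r, n) - frag_of (m, r \<triangleright>\<^bsub>N\<^esub> n) | m r n.
        m \<in> carrier M \<and> r \<in> carrier R \<and> n \<in> carrier N}"

definition tensor_null ::
    "('a, 'r) ring_scheme \<Rightarrow> ('a, 'm, 'x) rmodule_scheme \<Rightarrow> ('a, 'n, 'y) bimodule_scheme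
      \<Rightarrow> ('m \<times> 'n \<Rightarrow>\<^sub>0 int) set" where
  "tensor_null R M N =
     generate (free_Abelian_group (carrier M \<times> carrier N)) (tensor_relators R M N)"

definition tens ::
    "('a, 'r) ring_scheme \<Rightarrow> ('a, 'm, 'x) rmodule_scheme \<Rightarrow> ('a, 'n, 'y) bimodule_scheme
      \<Rightarrow> 'm \<Rightarrow> 'n \<Rightarrow> ('m \<times> 'n \<Rightarrow>\<^sub>0 int) set" where
  "tens R M N m n =
     tensor_null R M N #>\<^bsub>free_Abelian_group (carrier M \<times> carrier N)\<^esub> frag_of (m, n)"

definition tensor_group ::
    "('a, 'r) ring_scheme \<Rightarrow> ('a, 'm, 'x) rmodule_scheme \<Rightarrow> ('a, 'n, 'y) bimodule_scheme
      \<Rightarrow> ('m \<times> 'n \<Rightarrow>\<^sub>0 int) set ring" where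
  "tensor_group R M N =
     (let Q = free_Abelian_group (carrier M \<times> carrier N) Mod tensor_null R M N
      in \<lparr>carrier = carrier Q, monoid.mult = undefined, one = undefined,
          ring.zero = \<one>\<^bsub>Q\<^esub>, ring.add = monoid.mult Q\<rparr>)"

text \<open>The additive map out of a tensor product induced by \<open>m \<otimes> n \<mapsto> f m n\<close>.  If \<open>f\<close> is
  \<open>R\<close>-balanced, every representative of the coset \<open>X\<close> has the same image.\<close>

definition tensor_lift ::
    "('g, 'z) ring_scheme \<Rightarrow> ('m \<Rightarrow> 'n \<Rightarrow> 'g) \<Rightarrow> ('m \<times> 'n \<Rightarrow>\<^sub>0 int) set \<Rightarrow> 'g" where
  "tensor_lift G f X = the_elem
     ((\<lambda>c. \<Oplus>\<^bsub>G\<^esub>k\<in>Poly_Mapping.keys c. [Poly_Mapping.lookup c k] \<cdot>\<^bsub>G\<^esub> f (fst k) (snd k)) ` X)"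

definition tensor_right ::
    "('a, 'r) ring_scheme \<Rightarrow> ('a, 'm, 'x) rmodule_scheme \<Rightarrow> ('a, 'n, 'y) bimodule_scheme
      \<Rightarrow> ('a, ('m \<times> 'n \<Rightarrow>\<^sub>0 int) set) rmodule" where
  "tensor_right R M N = ring.extend (tensor_group R M N) (rmodule.fields
     (\<lambda>z a. tensor_lift (tensor_group R M N) (\<lambda>m n. tens R M N m (n \<triangleleft>\<^bsub>N\<^esub> a)) z))"

definition tensor_bi ::
    "('a, 'r) ring_scheme \<Rightarrow> ('a, 'm, 'x) bimodule_scheme \<Rightarrow> ('a, 'n, 'y) bimodule_scheme
      \<Rightarrow> ('a, ('m \<times> 'n \<Rightarrow>\<^sub>0 int) set) bimodule" where
  "tensor_bi R M N = rmodule.extend (tensor_right R M N) (bimodule.fields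
     (\<lambda>a z. tensor_lift (tensor_group R M N) (\<lambda>m n. tens R M N (a \<triangleright>\<^bsub>M\<^esub> m) n) z))"

definition tensor_map ::
    "('a, 'r) ring_scheme \<Rightarrow> ('a, 'm, 'x) rmodule_scheme \<Rightarrow> ('a, 'n, 'y) bimodule_scheme
      \<Rightarrow> ('k \<Rightarrow> 'm) \<Rightarrow> ('l \<Rightarrow> 'n) \<Rightarrow> ('k \<times> 'l \<Rightarrow>\<^sub>0 int) set \<Rightarrow> ('m \<times> 'n \<Rightarrow>\<^sub>0 int) set" where
  "tensor_map R M N f g = tensor_lift (tensor_group R M N) (\<lambda>k l. tens R M N (f k) (g l))"

text \<open>\<open>(M \<otimes>\<^sub>A N) \<otimes>\<^sub>A P \<rightarrow> M \<otimes>\<^sub>A (N \<otimes>\<^sub>A P)\<close>, \<open>(m \<otimes> n) \<otimes> p \<mapsto> m \<otimes> (n \<otimes> p)\<close>\<close>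

definition tensor_assoc ::
    "('a, 'r) ring_scheme \<Rightarrow> ('a, 'm, 'x) rmodule_scheme \<Rightarrow> ('a, 'n, 'y) bimodule_scheme
      \<Rightarrow> ('a, 'p, 'z) bimodule_scheme
      \<Rightarrow> (('m \<times> 'n \<Rightarrow>\<^sub>0 int) set \<times> 'p \<Rightarrow>\<^sub>0 int) set \<Rightarrow> ('m \<times> ('n \<times> 'p \<Rightarrow>\<^sub>0 int) set \<Rightarrow>\<^sub>0 int) set"
  where
  "tensor_assoc A M N P =
     (let T = tensor_group A M (tensor_bi A N P)
      in tensor_lift T (\<lambda>z p. tensor_lift T (\<lambda>m n. tens A M (tensor_bi A N P) m (tens A N P n p)) z))"


section \<open>Corings, comodules and Galois corings\<close>

record ('a, 'c) coring = "('a, 'c) bimodule" +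
  comult :: "'c \<Rightarrow> ('c \<times> 'c \<Rightarrow>\<^sub>0 int) set"
  counit :: "'c \<Rightarrow> 'a"

locale coring = bimodule A C
  for A :: "('a, 'r) ring_scheme" (structure) and C :: "('a, 'c, 'x) coring_scheme" (structure) +
  assumes comult_bilinear: "comult C \<in> bimodule_hom A C (tensor_bi A C C)"
    and counit_bilinear: "counit C \<in> bimodule_hom A C (regular_bimodule A)"
    and coassoc: "c \<in> carrier C \<Longrightarrow>
      tensor_assoc A C C C (tensor_map A (tensor_right A C C) C (comult C) id (comult C c)) =
      tensor_map A C (tensor_bi A C C) id (comult C) (comult C c)"
    and counit_left: "c \<in> carrier C \<Longrightarrow>
      tensor_lift C (\<lambda>d e. counit C d \<triangleright>\<^bsub>C\<^esub> e) (comult C c) = c"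
    and counit_right: "c \<in> carrier C \<Longrightarrow>
      tensor_lift C (\<lambda>d e. d \<triangleleft>\<^bsub>C\<^esub> counit C e) (comult C c) = c"

definition grouplike :: "('a, 'r) ring_scheme \<Rightarrow> ('a, 'c, 'z) coring_scheme \<Rightarrow> 'c \<Rightarrow> bool" where
  "grouplike A C x \<longleftrightarrow> x \<in> carrier C \<and> comult C x = tens A C C x x \<and> counit C x = \<one>\<^bsub>A\<^esub>"

record ('a, 'm, 'c) comodule = "('a, 'm) rmodule" +
  coact :: "'m \<Rightarrow> ('m \<times> 'c \<Rightarrow>\<^sub>0 int) set"

locale right_comodule = C: coring A C + right_module A M
  for A :: "('a, 'r) ring_scheme" (structure) and C :: "('a, 'c, 'x) coring_scheme" (structure)
    and M :: "('a, 'm, 'c, 'y) comodule_scheme" (structure) +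
  assumes coact_linear: "coact M \<in> right_linear A M (tensor_right A M C)"
    and coact_coassoc: "m \<in> carrier M \<Longrightarrow>
      tensor_assoc A M C C (tensor_map A (tensor_right A M C) C (coact M) id (coact M m)) =
      tensor_map A M (tensor_bi A C C) id (comult C) (coact M m)"
    and coact_counit: "m \<in> carrier M \<Longrightarrow>
      tensor_lift M (\<lambda>k c. k \<triangleleft>\<^bsub>M\<^esub> counit C c) (coact M m) = m"

definition regular_comodule ::
    "('a, 'r) ring_scheme \<Rightarrow> ('a, 'c, 'z) coring_scheme \<Rightarrow> 'c \<Rightarrow> ('a, 'a, 'c) comodule" where
  "regular_comodule A C x = rmodule.extend (rmodule.truncate (regular_bimodule A)) (comodule.fields
     (\<lambda>a. tens A (regular_bimodule A) C \<one>\<^bsub>A\<^esub> (x \<triangleleft>\<^bsub>C\<^esub> a)))"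

definition coinvariants ::
    "('a, 'r) ring_scheme \<Rightarrow> ('a, 'c, 'z) coring_scheme \<Rightarrow> 'c \<Rightarrow> 'a set" where
  "coinvariants A C x = {a \<in> carrier A.
     coact (regular_comodule A C x) a = tens A (regular_bimodule A) C a x}"

abbreviation coinvariant_ring ::
    "('a, 'r) ring_scheme \<Rightarrow> ('a, 'c, 'z) coring_scheme \<Rightarrow> 'c \<Rightarrow> ('a, 'r) ring_scheme" where
  "coinvariant_ring A C x \<equiv> A\<lparr>carrier := coinvariants A C x\<rparr>"

text \<open>The coring \<open>A \<otimes>\<^sub>B A\<close>.  The element \<open>a \<otimes> 1 \<otimes> b\<close> of \<open>A \<otimes>\<^sub>B A \<otimes>\<^sub>B A\<close> corresponds to
  \<open>(a \<otimes> 1) \<otimes> (1 \<otimes> b)\<close> in \<open>(A \<otimes>\<^sub>B A) \<otimes>\<^sub>A (A \<otimes>\<^sub>B A)\<close>.\<close>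

definition canonical_coring ::
    "('a, 'r) ring_scheme \<Rightarrow> 'a set \<Rightarrow> ('a, ('a \<times> 'a \<Rightarrow>\<^sub>0 int) set) coring" where
  "canonical_coring A B =
     (let A' = regular_bimodule A; t = tens (A\<lparr>carrier := B\<rparr>) A' A';
          D = tensor_bi (A\<lparr>carrier := B\<rparr>) A' A'
      in bimodule.extend D (coring.fields
           (tensor_lift (tensor_group A D D) (\<lambda>a b. tens A D D (t a \<one>\<^bsub>A\<^esub>) (t \<one>\<^bsub>A\<^esub> b)))
           (tensor_lift A (\<lambda>a b. a \<otimes>\<^bsub>A\<^esub> b))))"

definition coring_hom ::
    "('a, 'r) ring_scheme \<Rightarrow> ('a, 'c, 'x) coring_scheme \<Rightarrow> ('a, 'd, 'y) coring_scheme
      \<Rightarrow> ('c \<Rightarrow> 'd) set" where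
  "coring_hom A C D = {f \<in> bimodule_hom A C D. \<forall>c\<in>carrier C.
     comult D (f c) = tensor_map A D D f f (comult C c) \<and> counit D (f c) = counit C c}"

definition coring_iso ::
    "('a, 'r) ring_scheme \<Rightarrow> ('a, 'c, 'x) coring_scheme \<Rightarrow> ('a, 'd, 'y) coring_scheme
      \<Rightarrow> ('c \<Rightarrow> 'd) set" where
  "coring_iso A C D = {f \<in> coring_hom A C D. bij_betw f (carrier C) (carrier D)}"

definition can :: "('a, 'c, 'z) coring_scheme \<Rightarrow> 'c \<Rightarrow> ('a \<times> 'a \<Rightarrow>\<^sub>0 int) set \<Rightarrow> 'c" where
  "can C x = tensor_lift C (\<lambda>a b. (a \<triangleright>\<^bsub>C\<^esub> x) \<triangleleft>\<^bsub>C\<^esub> b)"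

definition galois_coring :: "('a, 'r) ring_scheme \<Rightarrow> ('a, 'c, 'z) coring_scheme \<Rightarrow> 'c \<Rightarrow> bool" where
  "galois_coring A C x \<longleftrightarrow>
     can C x \<in> coring_iso A (canonical_coring A (coinvariants A C x)) C"

end

theory Submission
  imports Defs
begin

text \<open>The isomorphism is evaluation at the grouplike element: \<open>F\<close> goes to \<open>m \<mapsto> F (m \<otimes> x)\<close>.
  Elements of \<open>B\<close> commute with \<open>x\<close>, so \<open>m b \<otimes> x = m \<otimes> b x = m \<otimes> x b = (m \<otimes> x) b\<close>, and the new map
  is \<open>B\<close>-linear (\<open>evaluate_linear\<close>).

  The Galois condition makes evaluation bijective.  Every element of \<open>\<C>\<close> is a sum of elements
  \<open>a x b\<close>, and \<open>F (m \<otimes> a x b) = F (m a \<otimes> x) b\<close> for \<open>A\<close>-linear \<open>F\<close>; hence \<open>F\<close> is determined by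
  its values at the \<open>m \<otimes> x\<close> (\<open>evaluate_inj\<close>).  Conversely, for a \<open>B\<close>-linear \<open>f\<close> the expression
  \<open>f (m a) b\<close> is \<open>B\<close>-balanced in \<open>(a, b)\<close> and defines an additive map on \<open>A \<otimes>\<^sub>B A\<close>.  Transporting it
  along the inverse of the canonical map gives an \<open>A\<close>-balanced function of \<open>(m, c)\<close>, that is, a map on
  \<open>M \<otimes>\<^sub>A \<C>\<close>.  It extends \<open>f\<close> because the canonical map sends \<open>1 \<otimes> 1\<close> to \<open>x\<close>
  (\<open>extension_exists\<close>).

  All this rests on the universal property of the tensor product: an additive map out of it
  is determined by its values on pure tensors (\<open>tensor_hom_eqI\<close>), and a balanced function
  extends to one (\<open>tensor_lift_hom\<close>, \<open>tensor_lift_tens\<close>).\<close>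

section \<open>Additive, linear and balanced maps\<close>

lemma add_monoid_hom_add:
  assumes "h \<in> hom (add_monoid G) (add_monoid H)" "y \<in> carrier G" "z \<in> carrier G"
  shows "h (y \<oplus>\<^bsub>G\<^esub> z) = h y \<oplus>\<^bsub>H\<^esub> h z"
  using hom_mult[OF assms(1)] assms(2,3) by simp

lemma add_monoid_hom_closed:
  assumes "h \<in> hom (add_monoid G) (add_monoid H)" "y \<in> carrier G"
  shows "h y \<in> carrier H"
  using hom_in_carrier[OF assms(1)] assms(2) by simp

lemma add_monoid_homI:
  assumes "\<And>y. y \<in> carrier G \<Longrightarrow> h y \<in> carrier H"
    and "\<And>y z. \<lbrakk>y \<in> carrier G; z \<in> carrier G\<rbrakk> \<Longrightarrow> h (y \<oplus>\<^bsub>G\<^esub> z) = h y \<oplus>\<^bsub>H\<^esub> h z"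
  shows "h \<in> hom (add_monoid G) (add_monoid H)"
  using assms by (auto intro!: homI)

lemma add_monoid_hom_comp:
  assumes "h \<in> hom (add_monoid G) (add_monoid H)" "k \<in> hom (add_monoid H) (add_monoid K)"
  shows "(\<lambda>y. k (h y)) \<in> hom (add_monoid G) (add_monoid K)"
  using hom_compose[OF assms] by (simp add: comp_def)

lemma (in abelian_group) add_monoid_hom_sum:
  assumes h: "h \<in> hom (add_monoid H) (add_monoid G)" and k: "k \<in> hom (add_monoid H) (add_monoid G)"
  shows "(\<lambda>y. h y \<oplus> k y) \<in> hom (add_monoid H) (add_monoid G)"
  by (rule add_monoid_homI)
    (simp_all add: add_monoid_hom_add[OF h] add_monoid_hom_add[OF k]
      add_monoid_hom_closed[OF h] add_monoid_hom_closed[OF k] a_ac)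

lemma (in abelian_group) minus_eq_zero_iff:
  "\<lbrakk>x \<in> carrier G; y \<in> carrier G\<rbrakk> \<Longrightarrow> x \<ominus> y = \<zero> \<longleftrightarrow> x = y"
  by (metis a_inv_closed add.inv_equality minus_eq minus_minus r_neg)

lemma (in abelian_group) minus_minus_eq_zero_iff:
  assumes "x \<in> carrier G" "y \<in> carrier G" "z \<in> carrier G"
  shows "x \<ominus> y \<ominus> z = \<zero> \<longleftrightarrow> x = y \<oplus> z"
proof -
  have "x \<ominus> y \<ominus> z = x \<ominus> (y \<oplus> z)"
    using assms by (simp add: minus_eq minus_add a_assoc)
  then show ?thesis using assms by (simp add: minus_eq_zero_iff)
qed

lemma (in right_module) ract_hom:
  "a \<in> carrier A \<Longrightarrow> (\<lambda>m. m \<triangleleft>\<^bsub>M\<^esub> a) \<in> hom (add_monoid M) (add_monoid M)"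
  by (rule add_monoid_homI) (simp_all add: ract_add_left)

lemma right_linear_closed:
  "\<lbrakk>f \<in> right_linear R M N; m \<in> carrier M\<rbrakk> \<Longrightarrow> f m \<in> carrier N"
  by (auto simp: right_linear_def hom_def)

lemma right_linear_add:
  "\<lbrakk>f \<in> right_linear R M N; m \<in> carrier M; m' \<in> carrier M\<rbrakk>
    \<Longrightarrow> f (m \<oplus>\<^bsub>M\<^esub> m') = f m \<oplus>\<^bsub>N\<^esub> f m'"
  by (simp add: right_linear_def hom_def)

lemma right_linear_ract:
  "\<lbrakk>f \<in> right_linear R M N; m \<in> carrier M; r \<in> carrier R\<rbrakk>
    \<Longrightarrow> f (m \<triangleleft>\<^bsub>M\<^esub> r) = f m \<triangleleft>\<^bsub>N\<^esub> r"
  by (simp add: right_linear_def)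

definition balanced ::
    "('a, 'r) ring_scheme \<Rightarrow> ('a, 'm, 'x) rmodule_scheme \<Rightarrow> ('a, 'n, 'y) bimodule_scheme
      \<Rightarrow> ('g, 'z) ring_scheme \<Rightarrow> ('m \<Rightarrow> 'n \<Rightarrow> 'g) \<Rightarrow> bool" where
  "balanced R M N G f \<longleftrightarrow>
     (\<forall>n\<in>carrier N. (\<lambda>m. f m n) \<in> hom (add_monoid M) (add_monoid G)) \<and>
     (\<forall>m\<in>carrier M. f m \<in> hom (add_monoid N) (add_monoid G)) \<and>
     (\<forall>m\<in>carrier M. \<forall>r\<in>carrier R. \<forall>n\<in>carrier N. f (m \<triangleleft>\<^bsub>M\<^esub> r) n = f m (r \<triangleright>\<^bsub>N\<^esub> n))"

lemma balancedI:
  assumes "\<And>m n. \<lbrakk>m \<in> carrier M; n \<in> carrier N\<rbrakk> \<Longrightarrow> f m n \<in> carrier G"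
    and "\<And>m m' n. \<lbrakk>m \<in> carrier M; m' \<in> carrier M; n \<in> carrier N\<rbrakk>
      \<Longrightarrow> f (m \<oplus>\<^bsub>M\<^esub> m') n = f m n \<oplus>\<^bsub>G\<^esub> f m' n"
    and "\<And>m n n'. \<lbrakk>m \<in> carrier M; n \<in> carrier N; n' \<in> carrier N\<rbrakk>
      \<Longrightarrow> f m (n \<oplus>\<^bsub>N\<^esub> n') = f m n \<oplus>\<^bsub>G\<^esub> f m n'"
    and "\<And>m r n. \<lbrakk>m \<in> carrier M; r \<in> carrier R; n \<in> carrier N\<rbrakk>
      \<Longrightarrow> f (m \<triangleleft>\<^bsub>M\<^esub> r) n = f m (r \<triangleright>\<^bsub>N\<^esub> n)"
  shows "balanced R M N G f"
  unfolding balanced_def using assms by (auto intro!: add_monoid_homI)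

lemma balanced_closed:
  "\<lbrakk>balanced R M N G f; m \<in> carrier M; n \<in> carrier N\<rbrakk> \<Longrightarrow> f m n \<in> carrier G"
  unfolding balanced_def by (blast intro: add_monoid_hom_closed)

lemma balanced_add_left:
  assumes "balanced R M N G f" "m \<in> carrier M" "m' \<in> carrier M" "n \<in> carrier N"
  shows "f (m \<oplus>\<^bsub>M\<^esub> m') n = f m n \<oplus>\<^bsub>G\<^esub> f m' n"
  using assms add_monoid_hom_add[of "\<lambda>m. f m n" M G] unfolding balanced_def by simp

lemma balanced_add_right:
  assumes "balanced R M N G f" "m \<in> carrier M" "n \<in> carrier N" "n' \<in> carrier N"
  shows "f m (n \<oplus>\<^bsub>N\<^esub> n') = f m n \<oplus>\<^bsub>G\<^esub> f m n'"
  using assms add_monoid_hom_add[of "f m" N G] unfolding balanced_def by simp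

lemma balanced_middle:
  "\<lbrakk>balanced R M N G f; m \<in> carrier M; r \<in> carrier R; n \<in> carrier N\<rbrakk>
    \<Longrightarrow> f (m \<triangleleft>\<^bsub>M\<^esub> r) n = f m (r \<triangleright>\<^bsub>N\<^esub> n)"
  by (simp add: balanced_def)

section \<open>The universal property of the tensor product\<close>

text \<open>A homomorphism out of the free group is necessarily the finite sum by which the lift of a
  balanced map is defined; additivity of that sum is then inherited from the homomorphism that the
  universal property of the free group provides.\<close>

lemma (in comm_group) free_Abelian_group_hom_eq_finprod:
  assumes h: "h \<in> hom (free_Abelian_group S) G" and c: "Poly_Mapping.keys c \<subseteq> S"
  shows "h c = finprod G (\<lambda>k. h (frag_of k) [^] Poly_Mapping.lookup c k) (Poly_Mapping.keys c)"
proof -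
  interpret F: comm_group "free_Abelian_group S" by (rule abelian_free_Abelian_group)
  interpret hh: group_hom "free_Abelian_group S" G h
    using h by (simp add: group_hom_def group_hom_axioms_def is_group)
  have *: "h (\<Sum>k\<in>T. frag_cmul (Poly_Mapping.lookup c k) (frag_of k)) =
      finprod G (\<lambda>k. h (frag_of k) [^] Poly_Mapping.lookup c k) T"
    if "finite T" "T \<subseteq> S" for T
    using that
  proof (induction T rule: finite_induct)
    case empty
    show ?case using hh.hom_one by simp
  next
    case (insert k T)
    let ?s = "\<lambda>k. frag_cmul (Poly_Mapping.lookup c k) (frag_of k)"
    have k: "frag_of k \<in> carrier (free_Abelian_group S)" using insert by simp
    have hk: "h (?s k) = h (frag_of k) [^] Poly_Mapping.lookup c k"
      using hh.hom_int_pow[OF k, of "Poly_Mapping.lookup c k"] insert.prems by simp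
    have mem: "?s i \<in> carrier (free_Abelian_group S)" if "i \<in> insert k T" for i
      using that insert.prems by (simp add: keys_cmul subset_iff)
        (meson in_keys_iff keys_cmul subset_iff)
    have "h (?s k + sum ?s T) = h (?s k) \<otimes> h (sum ?s T)"
      using hh.hom_mult[OF mem[of k] sum_closed_free_Abelian_group[of T ?s S]] mem by simp
    then show ?case
      using insert.IH insert.hyps insert.prems hh.hom_closed hk
      by (simp add: finprod_insert Pi_iff subset_iff)
  qed
  then show ?thesis using c
    by (subst (1) frag_expansion) (simp add: frag_extend_def)
qed

text \<open>\<open>R\<close> need not be \<open>A\<close>: for \<open>A \<otimes>\<^sub>B A\<close> the middle relation runs over \<open>B\<close> alone, while
  \<open>A\<close> still acts from outside.\<close>

locale tensor_product = M: right_module A M + N: bimodule A N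
  for A :: "('a, 'r) ring_scheme" (structure) and M :: "('a, 'm, 'x) rmodule_scheme" (structure)
    and N :: "('a, 'n, 'y) bimodule_scheme" (structure) +
  fixes R :: "('a, 'r2) ring_scheme"
  assumes scalars_subset: "carrier R \<subseteq> carrier A"
begin

abbreviation "F \<equiv> free_Abelian_group (carrier M \<times> carrier N)"
abbreviation "K \<equiv> tensor_null R M N"
abbreviation "T \<equiv> tensor_group R M N"
abbreviation "t \<equiv> tens R M N"

sublocale F: comm_group F
  by (rule abelian_free_Abelian_group)

lemma tensor_relators_subset: "tensor_relators R M N \<subseteq> carrier F"
proof
  fix c assume "c \<in> tensor_relators R M N"
  then have "\<exists>p q r. c = frag_of p - frag_of q - frag_of r \<and>
      {p, q, r} \<subseteq> carrier M \<times> carrier N \<or>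
      c = frag_of p - frag_of q \<and> {p, q} \<subseteq> carrier M \<times> carrier N"
    unfolding tensor_relators_def using scalars_subset by auto blast+
  then show "c \<in> carrier F"
    using keys_diff by (fastforce dest!: subsetD[OF keys_diff])
qed

sublocale K: normal K F
  unfolding tensor_null_def
  by (intro F.subgroup_imp_normal F.generate_is_subgroup tensor_relators_subset)

lemma tens_eq_coset: "t m n = K #>\<^bsub>F\<^esub> frag_of (m, n)"
  by (simp add: tens_def)

lemma add_monoid_tensor_group: "add_monoid T = F Mod K"
  by (simp add: tensor_group_def Let_def FactGroup_def)

lemma carrier_tensor_group: "carrier T = (\<lambda>c. K #>\<^bsub>F\<^esub> c) ` carrier F"
  by (simp add: tensor_group_def Let_def carrier_FactGroup)

lemma coset_hom: "(\<lambda>c. K #>\<^bsub>F\<^esub> c) \<in> hom F (add_monoid T)"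
  using K.r_coset_hom_Mod unfolding add_monoid_tensor_group .

sublocale T: abelian_group T
  using F.abelian_FactGroup[OF K.subgroup_axioms]
  by (metis abelian_group.intro abelian_group_axioms.intro abelian_monoid.intro
      add_monoid_tensor_group comm_group.axioms(1))

lemma coset_relator: "c \<in> tensor_relators R M N \<Longrightarrow> K #>\<^bsub>F\<^esub> c = \<zero>\<^bsub>T\<^esub>"
  using K.rcos_const[of c] 
  by (simp add: tensor_group_def Let_def tensor_null_def generate.incl)

lemma coset_diff:
  assumes "c \<in> carrier F" "d \<in> carrier F"
  shows "K #>\<^bsub>F\<^esub> (c - d) = (K #>\<^bsub>F\<^esub> c) \<ominus>\<^bsub>T\<^esub> (K #>\<^bsub>F\<^esub> d)"
proof -
  interpret c: group_hom F "add_monoid T" "\<lambda>c. K #>\<^bsub>F\<^esub> c"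
    using coset_hom T.a_group by (simp add: group_hom_def group_hom_axioms_def)
  show ?thesis
    using c.hom_mult[of c "-d"] c.hom_inv[of d] assms
    by (simp add: a_minus_def a_inv_def)
qed

lemma tens_closed [simp, intro]: "\<lbrakk>m \<in> carrier M; n \<in> carrier N\<rbrakk> \<Longrightarrow> t m n \<in> carrier T"
  by (simp add: tens_eq_coset carrier_tensor_group)

text \<open>Each clause of balancedness says that one kind of relator lies in the zero coset.\<close>

lemma tens_balanced: "balanced R M N T t"
proof -
  have eq3: "t m n = t m1 n1 \<oplus>\<^bsub>T\<^esub> t m2 n2"
    if rel: "frag_of (m, n) - frag_of (m1, n1) - frag_of (m2, n2) \<in> tensor_relators R M N"
      and mem: "m \<in> carrier M" "m1 \<in> carrier M" "m2 \<in> carrier M"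
        "n \<in> carrier N" "n1 \<in> carrier N" "n2 \<in> carrier N" for m n m1 n1 m2 n2
  proof -
    have "frag_of (m, n) - frag_of (m1, n1) \<in> carrier F"
      using mem keys_diff[of "frag_of (m, n)" "frag_of (m1, n1)"] by auto
    then have "(t m n \<ominus>\<^bsub>T\<^esub> t m1 n1) \<ominus>\<^bsub>T\<^esub> t m2 n2 = \<zero>\<^bsub>T\<^esub>"
      using coset_relator[OF rel] mem by (simp add: coset_diff tens_eq_coset)
    then show ?thesis using mem by (simp add: T.minus_minus_eq_zero_iff)
  qed
  have eq2: "t m n = t m1 n1"
    if rel: "frag_of (m, n) - frag_of (m1, n1) \<in> tensor_relators R M N"
      and mem: "m \<in> carrier M" "m1 \<in> carrier M" "n \<in> carrier N" "n1 \<in> carrier N" for m n m1 n1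
    using coset_relator[OF rel] mem by (simp add: coset_diff tens_eq_coset[symmetric] T.minus_eq_zero_iff)
  show ?thesis
  proof (rule balancedI)
    fix m m' n assume *: "m \<in> carrier M" "m' \<in> carrier M" "n \<in> carrier N"
    show "t (m \<oplus>\<^bsub>M\<^esub> m') n = t m n \<oplus>\<^bsub>T\<^esub> t m' n"
      by (rule eq3) (use * in \<open>auto simp: tensor_relators_def\<close>)
  next
    fix m n n' assume *: "m \<in> carrier M" "n \<in> carrier N" "n' \<in> carrier N"
    show "t m (n \<oplus>\<^bsub>N\<^esub> n') = t m n \<oplus>\<^bsub>T\<^esub> t m n'"
      by (rule eq3) (use * in \<open>auto simp: tensor_relators_def\<close>)
  next
    fix m r n assume *: "m \<in> carrier M" "r \<in> carrier R" "n \<in> carrier N"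
    show "t (m \<triangleleft>\<^bsub>M\<^esub> r) n = t m (r \<triangleright>\<^bsub>N\<^esub> n)"
      by (rule eq2) (use * scalars_subset in \<open>auto simp: tensor_relators_def\<close>)
  qed simp
qed

lemmas tens_add_left = balanced_add_left[OF tens_balanced]
  and tens_add_right = balanced_add_right[OF tens_balanced]
  and tens_middle = balanced_middle[OF tens_balanced]

text \<open>Cosets of the generators are the pure tensors, and equality of two homomorphisms passes from
  generators to the whole free group.\<close>

lemma tensor_hom_eqI:
  assumes G: "abelian_group G"
    and h: "h \<in> hom (add_monoid T) (add_monoid G)" and k: "k \<in> hom (add_monoid T) (add_monoid G)"
    and eq: "\<And>m n. \<lbrakk>m \<in> carrier M; n \<in> carrier N\<rbrakk> \<Longrightarrow> h (t m n) = k (t m n)"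
    and z: "z \<in> carrier T"
  shows "h z = k z"
proof -
  interpret G: abelian_group G by (rule G)
  interpret h: group_hom F "add_monoid G" "\<lambda>c. h (K #>\<^bsub>F\<^esub> c)"
    using hom_compose[OF coset_hom h] G.a_group
    by (simp add: group_hom_def group_hom_axioms_def comp_def)
  interpret k: group_hom F "add_monoid G" "\<lambda>c. k (K #>\<^bsub>F\<^esub> c)"
    using hom_compose[OF coset_hom k] G.a_group
    by (simp add: group_hom_def group_hom_axioms_def comp_def)
  have "h (K #>\<^bsub>F\<^esub> c) = k (K #>\<^bsub>F\<^esub> c)" if "Poly_Mapping.keys c \<subseteq> carrier M \<times> carrier N" for c
  proof (rule free_Abelian_group_induct[OF that])
    show "h (K #>\<^bsub>F\<^esub> 0) = k (K #>\<^bsub>F\<^esub> 0)" using h.hom_one k.hom_one by simp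
  next
    fix a b assume "Poly_Mapping.keys a \<subseteq> carrier M \<times> carrier N" "Poly_Mapping.keys b \<subseteq> carrier M \<times> carrier N"
      "h (K #>\<^bsub>F\<^esub> a) = k (K #>\<^bsub>F\<^esub> a)" "h (K #>\<^bsub>F\<^esub> b) = k (K #>\<^bsub>F\<^esub> b)"
    then show "h (K #>\<^bsub>F\<^esub> (a - b)) = k (K #>\<^bsub>F\<^esub> (a - b))"
      using h.hom_mult[of a "-b"] k.hom_mult[of a "-b"] h.hom_inv[of b] k.hom_inv[of b] by simp
  next
    fix p assume "p \<in> carrier M \<times> carrier N"
    then show "h (K #>\<^bsub>F\<^esub> frag_of p) = k (K #>\<^bsub>F\<^esub> frag_of p)" using eq by (auto simp: tens_eq_coset)
  qed
  then show ?thesis using z by (auto simp: carrier_tensor_group)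
qed

text \<open>The homomorphism on the free group that extends \<open>f\<close> kills every relator, hence the subgroup
  they generate; so it is constant on each coset, and this constant is the value of the lift.\<close>

lemma
  assumes G: "abelian_group G" and f: "balanced R M N G f"
  shows tensor_lift_hom: "tensor_lift G f \<in> hom (add_monoid T) (add_monoid G)"
    and tensor_lift_tens:
      "\<lbrakk>m \<in> carrier M; n \<in> carrier N\<rbrakk> \<Longrightarrow> tensor_lift G f (t m n) = f m n"
proof -
  interpret G: abelian_group G by (rule G)
  let ?S = "carrier M \<times> carrier N"
  let ?f = "\<lambda>p. f (fst p) (snd p)"
  have fc: "?f ` ?S \<subseteq> carrier (add_monoid G)" using balanced_closed[OF f] by auto
  obtain h where h: "h \<in> hom F (add_monoid G)" and hf: "\<And>p. p \<in> ?S \<Longrightarrow> h (frag_of p) = ?f p"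
    using comm_group.free_Abelian_group_universal[OF G.a_comm_group fc] by metis
  interpret h: group_hom F "add_monoid G" h
    using h G.a_group by (simp add: group_hom_def group_hom_axioms_def)
  have hdiff: "h (c - d) = h c \<ominus>\<^bsub>G\<^esub> h d" if "Poly_Mapping.keys c \<subseteq> ?S" "Poly_Mapping.keys d \<subseteq> ?S" for c d
    using h.hom_mult[of c "-d"] h.hom_inv[of d] that by (simp add: a_minus_def a_inv_def)
  have relz: "h c = \<zero>\<^bsub>G\<^esub>" if "c \<in> tensor_relators R M N" for c
  proof -
    have diffc: "Poly_Mapping.keys (frag_of p - frag_of q) \<subseteq> ?S" if "p \<in> ?S" "q \<in> ?S" for p q
      using that keys_diff[of "frag_of p" "frag_of q"] by auto
    show ?thesis
      using that unfolding tensor_relators_def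
    proof (elim UnE CollectE exE conjE)
      fix m m' n
      assume 1: "c = frag_of (m \<oplus>\<^bsub>M\<^esub> m', n) - frag_of (m, n) - frag_of (m', n)"
        "m \<in> carrier M" "m' \<in> carrier M" "n \<in> carrier N"
      then have "f (m \<oplus>\<^bsub>M\<^esub> m') n = f m n \<oplus>\<^bsub>G\<^esub> f m' n"
        by (intro balanced_add_left[OF f])
      then show ?thesis using 1 balanced_closed[OF f]
        by (simp add: hdiff diffc hf G.minus_minus_eq_zero_iff)
    next
      fix m n n'
      assume 2: "c = frag_of (m, n \<oplus>\<^bsub>N\<^esub> n') - frag_of (m, n) - frag_of (m, n')"
        "m \<in> carrier M" "n \<in> carrier N" "n' \<in> carrier N"
      then have "f m (n \<oplus>\<^bsub>N\<^esub> n') = f m n \<oplus>\<^bsub>G\<^esub> f m n'"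
        by (intro balanced_add_right[OF f])
      then show ?thesis using 2 balanced_closed[OF f]
        by (simp add: hdiff diffc hf G.minus_minus_eq_zero_iff)
    next
      fix m r n
      assume 3: "c = frag_of (m \<triangleleft>\<^bsub>M\<^esub> r, n) - frag_of (m, r \<triangleright>\<^bsub>N\<^esub> n)"
        "m \<in> carrier M" "r \<in> carrier R" "n \<in> carrier N"
      moreover have "r \<in> carrier A" using 3 scalars_subset by auto
      moreover have "f (m \<triangleleft>\<^bsub>M\<^esub> r) n = f m (r \<triangleright>\<^bsub>N\<^esub> n)"
        using 3 by (intro balanced_middle[OF f])
      ultimately show ?thesis using balanced_closed[OF f]
        by (simp add: hdiff hf G.minus_eq_zero_iff)
    qed
  qed
  have "K \<subseteq> kernel F (add_monoid G) h"
    unfolding tensor_null_def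
    by (rule F.generate_subgroup_incl)
      (use relz tensor_relators_subset h.subgroup_kernel in
        \<open>auto simp del: carrier_free_Abelian_group_iff simp: kernel_def\<close>)
  then have null: "h k = \<zero>\<^bsub>G\<^esub>" if "k \<in> K" for k using that by (auto simp: kernel_def)
  have lift: "tensor_lift G f (K #>\<^bsub>F\<^esub> c) = h c" if c: "c \<in> carrier F" for c
  proof -
    have *: "(\<Oplus>\<^bsub>G\<^esub>k\<in>Poly_Mapping.keys d. [Poly_Mapping.lookup d k] \<cdot>\<^bsub>G\<^esub> ?f k) = h c"
      if "d \<in> K #>\<^bsub>F\<^esub> c" for d
    proof -
      obtain k where k: "k \<in> K" "d = k + c" using \<open>d \<in> _\<close> unfolding r_coset_def by auto
      have kF: "k \<in> carrier F" using k K.subset by blast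
      have dF: "d \<in> carrier F" using F.m_closed[OF kF c] k by simp
      have "h d = h c" using h.hom_mult[OF kF c] h.hom_closed[OF c] null[OF k(1)] k(2) by simp
      moreover have "h d = (\<Oplus>\<^bsub>G\<^esub>k\<in>Poly_Mapping.keys d. [Poly_Mapping.lookup d k] \<cdot>\<^bsub>G\<^esub> h (frag_of k))"
        using comm_group.free_Abelian_group_hom_eq_finprod[OF G.a_comm_group h, of d] dF
        by (simp add: finsum_def add_pow_def)
      moreover have "\<dots> = (\<Oplus>\<^bsub>G\<^esub>k\<in>Poly_Mapping.keys d. [Poly_Mapping.lookup d k] \<cdot>\<^bsub>G\<^esub> ?f k)"
        using dF fc by (intro G.finsum_cong') (auto simp: hf subset_iff balanced_closed[OF f])
      ultimately show ?thesis by simp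
    qed
    have "K #>\<^bsub>F\<^esub> c \<noteq> {}" using F.rcos_self[OF c K.subgroup_axioms] by blast
    then have "(\<lambda>d. \<Oplus>\<^bsub>G\<^esub>k\<in>Poly_Mapping.keys d. [Poly_Mapping.lookup d k] \<cdot>\<^bsub>G\<^esub> ?f k)
        ` (K #>\<^bsub>F\<^esub> c) = {h c}"
      using * by (auto simp: image_iff)
    then show ?thesis unfolding tensor_lift_def by simp
  qed
  show "tensor_lift G f \<in> hom (add_monoid T) (add_monoid G)"
  proof (rule homI)
    fix X assume "X \<in> carrier (add_monoid T)"
    then show "tensor_lift G f X \<in> carrier (add_monoid G)"
      using h.hom_closed by (auto simp: carrier_tensor_group lift)
  next
    fix X Y assume "X \<in> carrier (add_monoid T)" "Y \<in> carrier (add_monoid T)"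
    then obtain c d where c: "c \<in> carrier F" "X = K #>\<^bsub>F\<^esub> c" and d: "d \<in> carrier F" "Y = K #>\<^bsub>F\<^esub> d"
      by (auto simp: carrier_tensor_group)
    have "X \<otimes>\<^bsub>add_monoid T\<^esub> Y = K #>\<^bsub>F\<^esub> (c + d)"
      using hom_mult[OF coset_hom c(1) d(1)] c d by simp
    then show "tensor_lift G f (X \<otimes>\<^bsub>add_monoid T\<^esub> Y) =
        tensor_lift G f X \<otimes>\<^bsub>add_monoid G\<^esub> tensor_lift G f Y"
      using lift[of "c + d"] F.m_closed[OF c(1) d(1)] h.hom_mult[OF c(1) d(1)] c d
      by (simp add: lift)
  qed
  show "tensor_lift G f (t m n) = f m n" if "m \<in> carrier M" "n \<in> carrier N"
    using lift[of "frag_of (m, n)"] that hf by (simp add: tens_eq_coset)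
qed

section \<open>Outer actions on a tensor product\<close>

lemma
  shows carrier_tensor_right: "carrier (tensor_right R M N) = carrier T"
    and add_tensor_right: "x \<oplus>\<^bsub>tensor_right R M N\<^esub> y = x \<oplus>\<^bsub>T\<^esub> y"
  by (simp_all add: tensor_right_def ring.defs rmodule.defs)

lemma right_linear_tensor_right_iff:
  "f \<in> right_linear S (tensor_right R M N) L \<longleftrightarrow> f \<in> hom (add_monoid T) (add_monoid L) \<and>
     (\<forall>z\<in>carrier T. \<forall>r\<in>carrier S. f (z \<triangleleft>\<^bsub>tensor_right R M N\<^esub> r) = f z \<triangleleft>\<^bsub>L\<^esub> r)"
  by (simp add: right_linear_def hom_def carrier_tensor_right add_tensor_right)

lemma
  assumes "a \<in> carrier A"
  shows tensor_ract_hom: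
      "(\<lambda>z. z \<triangleleft>\<^bsub>tensor_right R M N\<^esub> a) \<in> hom (add_monoid T) (add_monoid T)"
    and tensor_ract_tens:
      "\<lbrakk>m \<in> carrier M; n \<in> carrier N\<rbrakk> \<Longrightarrow> t m n \<triangleleft>\<^bsub>tensor_right R M N\<^esub> a = t m (n \<triangleleft>\<^bsub>N\<^esub> a)"
proof -
  have r: "z \<triangleleft>\<^bsub>tensor_right R M N\<^esub> a = tensor_lift T (\<lambda>m n. t m (n \<triangleleft>\<^bsub>N\<^esub> a)) z" for z
    by (simp add: tensor_right_def ring.defs rmodule.defs)
  have b: "balanced R M N T (\<lambda>m n. t m (n \<triangleleft>\<^bsub>N\<^esub> a))"
    by (rule balancedI) (use assms scalars_subset in \<open>auto simp: tens_add_left tens_add_right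
      N.ract_add_left tens_middle N.lact_ract subset_iff\<close>)
  show "(\<lambda>z. z \<triangleleft>\<^bsub>tensor_right R M N\<^esub> a) \<in> hom (add_monoid T) (add_monoid T)"
    unfolding r by (rule tensor_lift_hom[OF T.abelian_group_axioms b])
  show "t m n \<triangleleft>\<^bsub>tensor_right R M N\<^esub> a = t m (n \<triangleleft>\<^bsub>N\<^esub> a)" if "m \<in> carrier M" "n \<in> carrier N"
    unfolding r by (rule tensor_lift_tens[OF T.abelian_group_axioms b that])
qed

end

locale tensor_bimodule = M: bimodule A M + tensor_product A M N R
  for A :: "('a, 'r) ring_scheme" (structure) and M :: "('a, 'm, 'x) bimodule_scheme" (structure)
    and N :: "('a, 'n, 'y) bimodule_scheme" (structure) and R :: "('a, 'r2) ring_scheme"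
begin

lemma
  assumes "a \<in> carrier A"
  shows tensor_lact_hom: "(\<lambda>z. a \<triangleright>\<^bsub>tensor_bi R M N\<^esub> z) \<in> hom (add_monoid T) (add_monoid T)"
    and tensor_lact_tens:
      "\<lbrakk>m \<in> carrier M; n \<in> carrier N\<rbrakk> \<Longrightarrow> a \<triangleright>\<^bsub>tensor_bi R M N\<^esub> t m n = t (a \<triangleright>\<^bsub>M\<^esub> m) n"
proof -
  have l: "a \<triangleright>\<^bsub>tensor_bi R M N\<^esub> z = tensor_lift T (\<lambda>m n. t (a \<triangleright>\<^bsub>M\<^esub> m) n) z" for z
    by (simp add: tensor_bi_def rmodule.defs bimodule.defs)
  have b: "balanced R M N T (\<lambda>m n. t (a \<triangleright>\<^bsub>M\<^esub> m) n)"
    by (rule balancedI) (use assms scalars_subset in \<open>auto simp: tens_add_left tens_add_right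
      M.lact_add_right tens_middle[symmetric] M.lact_ract subset_iff\<close>)
  show "(\<lambda>z. a \<triangleright>\<^bsub>tensor_bi R M N\<^esub> z) \<in> hom (add_monoid T) (add_monoid T)"
    unfolding l by (rule tensor_lift_hom[OF T.abelian_group_axioms b])
  show "a \<triangleright>\<^bsub>tensor_bi R M N\<^esub> t m n = t (a \<triangleright>\<^bsub>M\<^esub> m) n" if "m \<in> carrier M" "n \<in> carrier N"
    unfolding l by (rule tensor_lift_tens[OF T.abelian_group_axioms b that])
qed

end

section \<open>The canonical map of a Galois coring\<close>

lemma regular_bimodule_simps [simp]:
  "carrier (regular_bimodule A) = carrier A"
  "a \<triangleleft>\<^bsub>regular_bimodule A\<^esub> b = a \<otimes>\<^bsub>A\<^esub> b"
  "a \<triangleright>\<^bsub>regular_bimodule A\<^esub> b = a \<otimes>\<^bsub>A\<^esub> b"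
  "a \<oplus>\<^bsub>regular_bimodule A\<^esub> b = a \<oplus>\<^bsub>A\<^esub> b"
  "\<zero>\<^bsub>regular_bimodule A\<^esub> = \<zero>\<^bsub>A\<^esub>"
  by (simp_all add: regular_bimodule_def)

lemma (in ring) bimodule_regular_bimodule: "bimodule R (regular_bimodule R)"
proof -
  have "abelian_group (regular_bimodule R)"
    by (rule abelian_groupI) (auto simp: a_ac intro: exI[of _ "\<ominus> _"] l_neg bexI[of _ "\<ominus> _"])
  then show ?thesis
    by (intro bimodule.intro right_module.intro right_module_axioms.intro bimodule_axioms.intro
        ring_axioms) (auto simp: l_distr r_distr m_assoc)
qed

lemma (in ring) regular_tensor_product:
  "\<lbrakk>S \<subseteq> carrier R; bimodule R C\<rbrakk> \<Longrightarrow> tensor_bimodule R (regular_bimodule R) C (R\<lparr>carrier := S\<rparr>)"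
  using bimodule_regular_bimodule
  by (intro tensor_bimodule.intro tensor_product.intro tensor_product_axioms.intro)
    (simp_all add: bimodule_def)

locale galois_bimodule = C: bimodule A C
  for A :: "('a, 'r) ring_scheme" (structure) and C :: "('a, 'c, 'x) coring_scheme" (structure) +
  fixes x :: 'c
  assumes x_closed [simp, intro]: "x \<in> carrier C"
    and galois: "galois_coring A C x"
begin

abbreviation "B \<equiv> coinvariants A C x"
abbreviation "A\<^sub>B \<equiv> coinvariant_ring A C x"
abbreviation "A\<^sub>A \<equiv> regular_bimodule A"

lemma coinvariant_closed: "b \<in> B \<Longrightarrow> b \<in> carrier A"
  by (simp add: coinvariants_def)

text \<open>The defining equation \<open>1 \<otimes> x b = b \<otimes> x\<close> of a coinvariant lives in \<open>A \<otimes>\<^sub>A \<C>\<close>; the action map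
  \<open>a \<otimes> c \<mapsto> a c\<close> carries it to \<open>\<C>\<close>.\<close>

lemma coinvariant_commutes:
  assumes b: "b \<in> B"
  shows "b \<triangleright>\<^bsub>C\<^esub> x = x \<triangleleft>\<^bsub>C\<^esub> b"
proof -
  interpret AC: tensor_bimodule A A\<^sub>A C A
    using C.regular_tensor_product[of "carrier A" C] C.bimodule_axioms by simp
  have bal: "balanced A A\<^sub>A C C (\<lambda>a c. a \<triangleright>\<^bsub>C\<^esub> c)"
    by (rule balancedI) (simp_all add: C.lact_add_left C.lact_add_right C.lact_mult)
  note lift = AC.tensor_lift_tens[OF C.abelian_group_axioms bal]
  have bA: "b \<in> carrier A" by (rule coinvariant_closed[OF b])
  have "tens A A\<^sub>A C \<one> (x \<triangleleft>\<^bsub>C\<^esub> b) = tens A A\<^sub>A C b x"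
    using b by (simp add: coinvariants_def regular_comodule_def rmodule.defs comodule.defs)
  then have "\<one> \<triangleright>\<^bsub>C\<^esub> (x \<triangleleft>\<^bsub>C\<^esub> b) = b \<triangleright>\<^bsub>C\<^esub> x"
    using lift[of \<one> "x \<triangleleft>\<^bsub>C\<^esub> b"] lift[of b x] bA by simp
  then show ?thesis using bA by simp
qed

sublocale D: tensor_bimodule A A\<^sub>A A\<^sub>A A\<^sub>B
  using C.regular_tensor_product[OF _ C.bimodule_regular_bimodule] coinvariant_closed by blast

abbreviation "D \<equiv> tensor_bi A\<^sub>B A\<^sub>A A\<^sub>A"

lemma canonical_coring_simps:
  "carrier (canonical_coring A B) = carrier D.T"
  "y \<oplus>\<^bsub>canonical_coring A B\<^esub> z = y \<oplus>\<^bsub>D.T\<^esub> z"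
  "z \<triangleleft>\<^bsub>canonical_coring A B\<^esub> a = z \<triangleleft>\<^bsub>tensor_right A\<^sub>B A\<^sub>A A\<^sub>A\<^esub> a"
  "a \<triangleright>\<^bsub>canonical_coring A B\<^esub> z = a \<triangleright>\<^bsub>D\<^esub> z"
  by (simp_all add: canonical_coring_def Let_def tensor_bi_def tensor_right_def
      ring.defs rmodule.defs bimodule.defs coring.defs)

lemma can_hom: "can C x \<in> hom (add_monoid D.T) (add_monoid C)"
  and can_ract: "\<lbrakk>z \<in> carrier D.T; a \<in> carrier A\<rbrakk>
    \<Longrightarrow> can C x (z \<triangleleft>\<^bsub>tensor_right A\<^sub>B A\<^sub>A A\<^sub>A\<^esub> a) = can C x z \<triangleleft>\<^bsub>C\<^esub> a"
  and can_lact: "\<lbrakk>z \<in> carrier D.T; a \<in> carrier A\<rbrakk>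
    \<Longrightarrow> can C x (a \<triangleright>\<^bsub>D\<^esub> z) = a \<triangleright>\<^bsub>C\<^esub> can C x z"
  and can_bij: "bij_betw (can C x) (carrier D.T) (carrier C)"
  using galois
  by (simp_all add: galois_coring_def coring_iso_def coring_hom_def bimodule_hom_def
      right_linear_def hom_def canonical_coring_simps)

text \<open>The function \<open>(a, b) \<mapsto> a x b\<close> is \<open>B\<close>-balanced because \<open>x\<close> commutes with the coinvariants, so
  the lift that defines the canonical map has the expected values.\<close>

lemma can_tens:
  assumes "a \<in> carrier A" "b \<in> carrier A"
  shows "can C x (D.t a b) = a \<triangleright>\<^bsub>C\<^esub> x \<triangleleft>\<^bsub>C\<^esub> b"
proof -
  have "balanced A\<^sub>B A\<^sub>A A\<^sub>A C (\<lambda>a b. (a \<triangleright>\<^bsub>C\<^esub> x) \<triangleleft>\<^bsub>C\<^esub> b)"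
    by (rule balancedI) (simp_all add: C.lact_add_left C.ract_add_left C.ract_add_right
      C.lact_mult C.ract_mult C.lact_ract coinvariant_commutes coinvariant_closed)
  from D.tensor_lift_tens[OF C.abelian_group_axioms this, of a b]
  show ?thesis using assms by (simp add: can_def C.lact_ract)
qed

definition can_inv :: "'c \<Rightarrow> ('a \<times> 'a \<Rightarrow>\<^sub>0 int) set" where
  "can_inv = inv_into (carrier D.T) (can C x)"

lemma can_inv_can: "z \<in> carrier D.T \<Longrightarrow> can_inv (can C x z) = z"
  using can_bij by (simp add: can_inv_def bij_betw_inv_into_left)

lemma can_inv_closed: "c \<in> carrier C \<Longrightarrow> can_inv c \<in> carrier D.T"
  and can_can_inv: "c \<in> carrier C \<Longrightarrow> can C x (can_inv c) = c"
  using can_bij by (auto simp: can_inv_def bij_betw_inv_into_right bij_betw_def inv_into_into)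

lemma can_inv_hom: "can_inv \<in> hom (add_monoid C) (add_monoid D.T)"
  using Group.group.iso_set_sym[OF D.T.a_group, of "can C x" "add_monoid C"] can_hom can_bij
  by (simp add: can_inv_def iso_def)

lemma can_inv_lact:
  assumes "a \<in> carrier A" "c \<in> carrier C"
  shows "can_inv (a \<triangleright>\<^bsub>C\<^esub> c) = a \<triangleright>\<^bsub>D\<^esub> can_inv c"
  using can_lact[OF can_inv_closed] add_monoid_hom_closed[OF D.tensor_lact_hom]
  by (metis assms can_can_inv can_inv_can can_inv_closed)

lemma can_inv_ract:
  assumes "a \<in> carrier A" "c \<in> carrier C"
  shows "can_inv (c \<triangleleft>\<^bsub>C\<^esub> a) = can_inv c \<triangleleft>\<^bsub>tensor_right A\<^sub>B A\<^sub>A A\<^sub>A\<^esub> a"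
  using can_ract[OF can_inv_closed] add_monoid_hom_closed[OF D.tensor_ract_hom]
  by (metis assms can_can_inv can_inv_can can_inv_closed)

lemma can_inv_x: "can_inv x = D.t \<one> \<one>"
  using can_inv_can[of "D.t \<one> \<one>"] by (simp add: can_tens)

end

section \<open>Evaluation at the grouplike element\<close>

locale galois_hom = galois_bimodule A C x + M: right_module A M + N: right_module A N
  for A :: "('a, 'r) ring_scheme" (structure) and C :: "('a, 'c, 'x) coring_scheme" (structure)
    and x :: 'c and M :: "('a, 'm, 'y) rmodule_scheme" (structure)
    and N :: "('a, 'n, 'z) rmodule_scheme" (structure)
begin

sublocale MC: tensor_product A M C A
  by unfold_locales simp

abbreviation "MC \<equiv> tensor_right A M C"

definition evaluate :: "(('m \<times> 'c \<Rightarrow>\<^sub>0 int) set \<Rightarrow> 'n) \<Rightarrow> 'm \<Rightarrow> 'n" where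
  "evaluate F = (\<lambda>m\<in>carrier M. F (MC.t m x))"

lemma evaluate_linear:
  assumes F: "F \<in> right_linear A MC N"
  shows "evaluate F \<in> right_linear A\<^sub>B M N"
proof -
  have Fhom: "F \<in> hom (add_monoid MC.T) (add_monoid N)"
    using F by (simp add: MC.right_linear_tensor_right_iff)
  have Fr: "F (z \<triangleleft>\<^bsub>MC\<^esub> a) = F z \<triangleleft>\<^bsub>N\<^esub> a" if "z \<in> carrier MC.T" "a \<in> carrier A" for z a
    using F that by (simp add: MC.right_linear_tensor_right_iff)
  have add: "evaluate F \<in> hom (add_monoid M) (add_monoid N)"
    by (rule add_monoid_homI)
      (simp_all add: evaluate_def MC.tens_add_left add_monoid_hom_add[OF Fhom]
        add_monoid_hom_closed[OF Fhom])
  moreover have "evaluate F (m \<triangleleft>\<^bsub>M\<^esub> b) = evaluate F m \<triangleleft>\<^bsub>N\<^esub> b" if m: "m \<in> carrier M" and b: "b \<in> B" for m b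
  proof -
    have bA: "b \<in> carrier A" by (rule coinvariant_closed[OF b])
    have "MC.t (m \<triangleleft>\<^bsub>M\<^esub> b) x = MC.t m x \<triangleleft>\<^bsub>MC\<^esub> b"
      using m bA by (simp add: MC.tens_middle MC.tensor_ract_tens coinvariant_commutes[OF b])
    then show ?thesis using m bA by (simp add: evaluate_def Fr)
  qed
  ultimately show ?thesis by (simp add: right_linear_def)
qed

lemma evaluate_hom: "evaluate \<in> hom (Hom_group A MC N) (Hom_group A\<^sub>B M N)"
proof (rule homI)
  fix F assume "F \<in> carrier (Hom_group A MC N)"
  then show "evaluate F \<in> carrier (Hom_group A\<^sub>B M N)"
    using evaluate_linear by (simp add: Hom_group_def) (simp add: evaluate_def)
next
  fix F G assume "F \<in> carrier (Hom_group A MC N)" "G \<in> carrier (Hom_group A MC N)"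
  show "evaluate (F \<otimes>\<^bsub>Hom_group A MC N\<^esub> G) = evaluate F \<otimes>\<^bsub>Hom_group A\<^sub>B M N\<^esub> evaluate G"
    by (auto simp: Hom_group_def evaluate_def MC.carrier_tensor_right)
qed

text \<open>For fixed \<open>m\<close>, the maps \<open>z \<mapsto> F (m \<otimes> can z)\<close> on \<open>A \<otimes>\<^sub>B A\<close> are additive, so it is enough to compare
  them at \<open>a \<otimes> b\<close>, where \<open>m \<otimes> can (a \<otimes> b) = (m a \<otimes> x) b\<close>.  Surjectivity of the canonical map then
  yields all \<open>m \<otimes> c\<close>.\<close>

lemma evaluate_inj: "inj_on evaluate (carrier (Hom_group A MC N))"
proof (rule inj_onI)
  fix F G
  assume F: "F \<in> carrier (Hom_group A MC N)" and G: "G \<in> carrier (Hom_group A MC N)"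
    and eq: "evaluate F = evaluate G"
  have hom: "H \<in> hom (add_monoid MC.T) (add_monoid N)" and
    r: "\<lbrakk>z \<in> carrier MC.T; a \<in> carrier A\<rbrakk> \<Longrightarrow> H (z \<triangleleft>\<^bsub>MC\<^esub> a) = H z \<triangleleft>\<^bsub>N\<^esub> a"
    if "H \<in> carrier (Hom_group A MC N)" for H z a
    using that by (simp_all add: Hom_group_def MC.right_linear_tensor_right_iff)
  have x_eq: "F (MC.t m x) = G (MC.t m x)" if "m \<in> carrier M" for m
    using fun_cong[OF eq, of m] that by (simp add: evaluate_def)
  have tens_can: "(\<lambda>z. MC.t m (can C x z)) \<in> hom (add_monoid D.T) (add_monoid MC.T)"
    if "m \<in> carrier M" for m
    by (rule add_monoid_hom_comp[OF can_hom])
      (use that MC.tens_balanced in \<open>simp add: balanced_def\<close>)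
  have "F (MC.t m (can C x z)) = G (MC.t m (can C x z))"
    if m: "m \<in> carrier M" and z: "z \<in> carrier D.T" for m z
  proof (rule D.tensor_hom_eqI[OF N.abelian_group_axioms _ _ _ z])
    show "(\<lambda>z. F (MC.t m (can C x z))) \<in> hom (add_monoid D.T) (add_monoid N)"
      by (rule add_monoid_hom_comp[OF tens_can[OF m] hom[OF F]])
    show "(\<lambda>z. G (MC.t m (can C x z))) \<in> hom (add_monoid D.T) (add_monoid N)"
      by (rule add_monoid_hom_comp[OF tens_can[OF m] hom[OF G]])
    fix a b assume "a \<in> carrier A\<^sub>A" "b \<in> carrier A\<^sub>A"
    then have ab: "a \<in> carrier A" "b \<in> carrier A" by simp_all
    have "MC.t m (can C x (D.t a b)) = MC.t (m \<triangleleft>\<^bsub>M\<^esub> a) x \<triangleleft>\<^bsub>MC\<^esub> b"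
      using m ab by (simp add: can_tens MC.tensor_ract_tens MC.tens_middle)
    then show "F (MC.t m (can C x (D.t a b))) = G (MC.t m (can C x (D.t a b)))"
      using m ab by (simp add: r[OF F] r[OF G] x_eq)
  qed
  then have tens_eq: "F (MC.t m c) = G (MC.t m c)" if "m \<in> carrier M" "c \<in> carrier C" for m c
    using that can_inv_closed can_can_inv by metis
  show "F = G"
  proof (rule extensionalityI[of _ "carrier MC"])
    show "F \<in> extensional (carrier MC)" "G \<in> extensional (carrier MC)"
      using F G by (simp_all add: Hom_group_def)
    show "F z = G z" if "z \<in> carrier MC" for z
      using MC.tensor_hom_eqI[OF N.abelian_group_axioms hom[OF F] hom[OF G] tens_eq] that
      by (simp add: MC.carrier_tensor_right)
  qed
qed

section \<open>Extending a linear map over the coinvariants\<close>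

definition induced :: "('m \<Rightarrow> 'n) \<Rightarrow> 'm \<Rightarrow> ('a \<times> 'a \<Rightarrow>\<^sub>0 int) set \<Rightarrow> 'n" where
  "induced f m = tensor_lift N (\<lambda>a b. f (m \<triangleleft>\<^bsub>M\<^esub> a) \<triangleleft>\<^bsub>N\<^esub> b)"

context
  fixes f
  assumes f: "f \<in> right_linear A\<^sub>B M N"
begin

lemma induced_balanced:
  assumes m: "m \<in> carrier M"
  shows "balanced A\<^sub>B A\<^sub>A A\<^sub>A N (\<lambda>a b. f (m \<triangleleft>\<^bsub>M\<^esub> a) \<triangleleft>\<^bsub>N\<^esub> b)"
  by (rule balancedI)
    (use m in \<open>simp_all add: right_linear_closed[OF f] right_linear_add[OF f] M.ract_add_right
      N.ract_add_left N.ract_add_right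
      M.ract_mult N.ract_mult right_linear_ract[OF f] coinvariant_closed\<close>)

lemma induced_hom: "m \<in> carrier M \<Longrightarrow> induced f m \<in> hom (add_monoid D.T) (add_monoid N)"
  unfolding induced_def by (rule D.tensor_lift_hom[OF N.abelian_group_axioms induced_balanced])

lemma induced_tens:
  "\<lbrakk>m \<in> carrier M; a \<in> carrier A; b \<in> carrier A\<rbrakk>
    \<Longrightarrow> induced f m (D.t a b) = f (m \<triangleleft>\<^bsub>M\<^esub> a) \<triangleleft>\<^bsub>N\<^esub> b"
  unfolding induced_def by (simp add: D.tensor_lift_tens[OF N.abelian_group_axioms induced_balanced])

lemma induced_add:
  assumes m: "m \<in> carrier M" "m' \<in> carrier M" and z: "z \<in> carrier D.T"
  shows "induced f (m \<oplus>\<^bsub>M\<^esub> m') z = induced f m z \<oplus>\<^bsub>N\<^esub> induced f m' z"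
proof (rule D.tensor_hom_eqI[OF N.abelian_group_axioms _ _ _ z])
  show "induced f (m \<oplus>\<^bsub>M\<^esub> m') \<in> hom (add_monoid D.T) (add_monoid N)"
    using m by (intro induced_hom) simp
  show "(\<lambda>z. induced f m z \<oplus>\<^bsub>N\<^esub> induced f m' z) \<in> hom (add_monoid D.T) (add_monoid N)"
    using m by (intro N.add_monoid_hom_sum induced_hom)
qed (use m in \<open>simp add: induced_tens M.ract_add_left right_linear_add[OF f] right_linear_closed[OF f] N.ract_add_left\<close>)

text \<open>Both sides send \<open>a \<otimes> b\<close> to \<open>f (m r a) b\<close>.  This becomes the \<open>A\<close>-balancedness of the extension
  to \<open>M \<otimes>\<^sub>A \<C>\<close>.\<close>

lemma induced_lact:
  assumes m: "m \<in> carrier M" and r: "r \<in> carrier A" and z: "z \<in> carrier D.T"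
  shows "induced f (m \<triangleleft>\<^bsub>M\<^esub> r) z = induced f m (r \<triangleright>\<^bsub>D\<^esub> z)"
proof (rule D.tensor_hom_eqI[OF N.abelian_group_axioms _ _ _ z])
  show "induced f (m \<triangleleft>\<^bsub>M\<^esub> r) \<in> hom (add_monoid D.T) (add_monoid N)"
    using m r by (intro induced_hom) simp
  show "(\<lambda>z. induced f m (r \<triangleright>\<^bsub>D\<^esub> z)) \<in> hom (add_monoid D.T) (add_monoid N)"
    by (rule add_monoid_hom_comp[OF D.tensor_lact_hom[OF r] induced_hom[OF m]])
qed (use m r in \<open>simp add: induced_tens D.tensor_lact_tens M.ract_mult\<close>)

text \<open>Both sides send \<open>a \<otimes> b\<close> to \<open>f (m a) b r\<close>.  This becomes the right \<open>A\<close>-linearity of the extension.\<close>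

lemma induced_ract:
  assumes m: "m \<in> carrier M" and r: "r \<in> carrier A" and z: "z \<in> carrier D.T"
  shows "induced f m (z \<triangleleft>\<^bsub>tensor_right A\<^sub>B A\<^sub>A A\<^sub>A\<^esub> r) = induced f m z \<triangleleft>\<^bsub>N\<^esub> r"
proof (rule D.tensor_hom_eqI[OF N.abelian_group_axioms _ _ _ z])
  show "(\<lambda>z. induced f m (z \<triangleleft>\<^bsub>tensor_right A\<^sub>B A\<^sub>A A\<^sub>A\<^esub> r)) \<in> hom (add_monoid D.T) (add_monoid N)"
    by (rule add_monoid_hom_comp[OF D.tensor_ract_hom[OF r] induced_hom[OF m]])
  show "(\<lambda>z. induced f m z \<triangleleft>\<^bsub>N\<^esub> r) \<in> hom (add_monoid D.T) (add_monoid N)"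
    by (rule add_monoid_hom_comp[OF induced_hom[OF m] N.ract_hom[OF r]])
qed (use m r in \<open>simp add: induced_tens D.tensor_ract_tens right_linear_closed[OF f] N.ract_mult\<close>)

text \<open>The inverse of the canonical map is \<open>A\<close>-bilinear, so \<open>induced f m \<circ> can\<^sup>-\<^sup>1\<close> inherits the two
  identities above; at \<open>m \<otimes> x\<close> the extension is \<open>f (m 1) 1\<close> because \<open>can (1 \<otimes> 1) = x\<close>.\<close>

lemma extension_exists: "\<exists>G\<in>right_linear A MC N. \<forall>m\<in>carrier M. G (MC.t m x) = f m"
proof
  let ?g = "\<lambda>m c. induced f m (can_inv c)"
  let ?G = "tensor_lift N ?g"
  have bal: "balanced A M C N ?g"
    by (rule balancedI)
      (simp_all add: add_monoid_hom_closed[OF induced_hom] can_inv_closed induced_add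
        add_monoid_hom_add[OF induced_hom] add_monoid_hom_add[OF can_inv_hom] induced_lact can_inv_lact)
  note Ghom = MC.tensor_lift_hom[OF N.abelian_group_axioms bal]
    and Gtens = MC.tensor_lift_tens[OF N.abelian_group_axioms bal]
  have "?G (z \<triangleleft>\<^bsub>MC\<^esub> r) = ?G z \<triangleleft>\<^bsub>N\<^esub> r" if z: "z \<in> carrier MC.T" and r: "r \<in> carrier A" for z r
  proof (rule MC.tensor_hom_eqI[OF N.abelian_group_axioms _ _ _ z])
    show "(\<lambda>z. ?G (z \<triangleleft>\<^bsub>MC\<^esub> r)) \<in> hom (add_monoid MC.T) (add_monoid N)"
      by (rule add_monoid_hom_comp[OF MC.tensor_ract_hom[OF r] Ghom])
    show "(\<lambda>z. ?G z \<triangleleft>\<^bsub>N\<^esub> r) \<in> hom (add_monoid MC.T) (add_monoid N)"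
      by (rule add_monoid_hom_comp[OF Ghom N.ract_hom[OF r]])
  qed (use r in \<open>simp add: MC.tensor_ract_tens Gtens can_inv_ract induced_ract can_inv_closed\<close>)
  then show "?G \<in> right_linear A MC N"
    using Ghom by (simp add: MC.right_linear_tensor_right_iff)
  show "\<forall>m\<in>carrier M. ?G (MC.t m x) = f m"
    by (simp add: Gtens can_inv_x induced_tens right_linear_closed[OF f])
qed

end

lemma evaluate_surj: "evaluate ` carrier (Hom_group A MC N) = carrier (Hom_group A\<^sub>B M N)"
proof
  show "evaluate ` carrier (Hom_group A MC N) \<subseteq> carrier (Hom_group A\<^sub>B M N)"
    using hom_carrier[OF evaluate_hom] .
  show "carrier (Hom_group A\<^sub>B M N) \<subseteq> evaluate ` carrier (Hom_group A MC N)"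
  proof
    fix f assume "f \<in> carrier (Hom_group A\<^sub>B M N)"
    then have f: "f \<in> right_linear A\<^sub>B M N" and ext: "f \<in> extensional (carrier M)"
      by (simp_all add: Hom_group_def)
    obtain G where G: "G \<in> right_linear A MC N" and Gf: "\<And>m. m \<in> carrier M \<Longrightarrow> G (MC.t m x) = f m"
      using extension_exists[OF f] by blast
    \<comment> \<open>elements of the Hom group are undefined outside the carrier\<close>
    let ?G = "restrict G (carrier MC)"
    have "?G \<in> right_linear A MC N"
      using G add_monoid_hom_closed[OF MC.tensor_ract_hom]
      by (auto simp: right_linear_def hom_def MC.carrier_tensor_right MC.add_tensor_right)
    then have "?G \<in> carrier (Hom_group A MC N)" by (simp add: Hom_group_def)
    moreover have "evaluate ?G = f"
      using ext by (intro extensionalityI[of _ "carrier M"])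
        (auto simp: evaluate_def MC.carrier_tensor_right Gf)
    ultimately show "f \<in> evaluate ` carrier (Hom_group A MC N)" by blast
  qed
qed

lemma evaluate_iso: "evaluate \<in> iso (Hom_group A MC N) (Hom_group A\<^sub>B M N)"
  using evaluate_hom evaluate_inj evaluate_surj by (simp add: iso_def bij_betw_def)

end

theorem theorem2p1:
  fixes A :: "('a, 'r) ring_scheme" and C :: "('a, 'c, 'x) coring_scheme" and x :: 'c
    and M :: "('a, 'm, 'c, 'y) comodule_scheme" and N :: "('a, 'n, 'z) rmodule_scheme"
  assumes "ring A"
    and "coring A C"
    and "grouplike A C x"
    and "galois_coring A C x"
    and "right_comodule A C M"
    and "right_module A N"
  shows "Hom_group A (tensor_right A M C) N \<cong> Hom_group (coinvariant_ring A C x) M N"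
proof -
  interpret galois_hom A C x M N
    using assms
    by (auto simp: galois_hom_def galois_bimodule_def galois_bimodule_axioms_def coring_def
        grouplike_def right_comodule_def)
  show ?thesis by (rule is_isoI[OF evaluate_iso])
qed

end
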